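(* Let $n\ge1$ and $\rho \in [0,1)$. Let $f:\mathbb{F}_2^n \to \{\pm 1\}$ be a Boolean function (not necessarily unbiased). Then $$G(n,f,f,\rho) \le \max_{1\le k \le n} \frac{k^2 \rho^{2(k-1)}}{1-\rho^{2k}}.$$
   Context: $\mathbb{F}_2=\{0,1\}$. For $\rho\in[-1,1]$, a pair $(X^n,Y^n)$ of random vectors in $\mathbb{F}_2^n$ is called $\rho$-correlated if $X^n$ is uniform on $\mathbb{F}_2^n$ and, independently for each $i\in\{1,\dots,n\}$, $Y_i=X_i$ with probability $\frac{1+\rho}{2}$ and $Y_i=X_i+1$ with probability $\frac{1-\rho}{2}$. For functions $f,g:\mathbb{F}_2^n\to\{\pm1\}$, $P_{f(X^n)g(Y^n),\rho}$ denotes the joint distribution on $\{\pm1\}^2$ of $(f(X^n),g(Y^n))$ when $(X^n,Y^n)$ is $\rho$-correlated. For $\rho\in(-1,1)$, the Fisher information of the family $\{P_{f(X^n)g(Y^n),\rho}\}_{\rho\in(-1,1)}$ is $$G(n,f,g,\rho) := \mathbb{E}\bigg[ \bigg( \frac{d}{d\rho} \ln P_{f(X^n)g(Y^n),\rho}(f(X^n),g(Y^n)) \bigg)^2 \bigg],$$ the expectation being over a $\rho$-correlated pair, i.e. $G(n,f,g,\rho)=\sum_{u,v}\big(\frac{d}{d\rho}P_{f(X^n)g(Y^n),\rho}(u,v)\big)^2/P_{f(X^n)g(Y^n),\rho}(u,v)$, summed over $(u,v)\in\{\pm1\}^2$ of positive probability. Convention: $0^0=1$. *)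

theory Defs
  imports "HOL-Probability.Probability" "HOL-Library.Z2"
begin

text \<open>
  A vector in \<open>F\<^sub>2\<^sup>n\<close> is a function on the positions \<open>1, \<dots>, n\<close>, extended by \<open>0\<close> elsewhere, so that
  the carrier is finite and closed under pointwise addition.
\<close>

definition F2_vecs :: "nat \<Rightarrow> (nat \<Rightarrow> bit) set" where
  "F2_vecs n = {x. \<forall>i. i \<notin> {1..n} \<longrightarrow> x i = 0}"

text \<open>
  The noise bits are independent, each equal to \<open>0\<close> with probability \<open>(1 + \<rho>) / 2\<close> and to \<open>1\<close>
  otherwise. This is meaningful only for \<open>\<rho> \<in> {-1..1}\<close>: Bernoulli parameters outside the unit
  interval are clamped by the library.
\<close>

definition noise_pmf :: "nat \<Rightarrow> real \<Rightarrow> (nat \<Rightarrow> bit) pmf" where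
  "noise_pmf n \<rho> =
     Pi_pmf {1..n} 0 (\<lambda>_. map_pmf (\<lambda>b. if b then 0 else 1) (bernoulli_pmf ((1 + \<rho>) / 2)))"

definition correlated_pmf :: "nat \<Rightarrow> real \<Rightarrow> ((nat \<Rightarrow> bit) \<times> (nat \<Rightarrow> bit)) pmf" where
  "correlated_pmf n \<rho> =
     map_pmf (\<lambda>(x, z). (x, \<lambda>i. x i + z i)) (pair_pmf (pmf_of_set (F2_vecs n)) (noise_pmf n \<rho>))"

definition output_pmf ::
  "nat \<Rightarrow> ((nat \<Rightarrow> bit) \<Rightarrow> real) \<Rightarrow> ((nat \<Rightarrow> bit) \<Rightarrow> real) \<Rightarrow> real \<Rightarrow> (real \<times> real) pmf" where
  "output_pmf n f g \<rho> = map_pmf (\<lambda>(x, y). (f x, g y)) (correlated_pmf n \<rho>)"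

text \<open>
  The expectation only involves output pairs that have positive probability at \<open>\<rho>\<close>; for
  \<open>\<rho> \<in> {-1<..<1}\<close> their probabilities are positive and smooth near \<open>\<rho>\<close>, so the logarithm and
  its derivative are meaningful there.
\<close>

definition fisher_info ::
  "nat \<Rightarrow> ((nat \<Rightarrow> bit) \<Rightarrow> real) \<Rightarrow> ((nat \<Rightarrow> bit) \<Rightarrow> real) \<Rightarrow> real \<Rightarrow> real" where
  "fisher_info n f g \<rho> =
     measure_pmf.expectation (correlated_pmf n \<rho>)
       (\<lambda>(x, y). (deriv (\<lambda>r. ln (pmf (output_pmf n f g r) (f x, g y))) \<rho>)\<^sup>2)"

lemma UNIV_bit: "(UNIV :: bit set) = {0, 1}"
  using bit_not_zero_iff by auto

lemma F2_vecs_eq_PiE_dflt: "F2_vecs n = PiE_dflt {1..n} 0 (\<lambda>_. UNIV)"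
  by (auto simp: F2_vecs_def PiE_dflt_def)

lemma finite_F2_vecs [simp]: "finite (F2_vecs n)"
  unfolding F2_vecs_eq_PiE_dflt by (intro finite_PiE_dflt) (simp_all add: UNIV_bit)

lemma F2_vecs_nonempty [simp]: "F2_vecs n \<noteq> {}"
  by (auto simp: F2_vecs_def)

lemma card_F2_vecs: "card (F2_vecs n) = 2 ^ n"
  unfolding F2_vecs_eq_PiE_dflt by (subst card_PiE_dflt) (simp_all add: UNIV_bit numeral_2_eq_2)

lemma pmf_correlated_pmf:
  assumes \<rho>: "\<rho> \<in> {-1..1}" and xy: "x \<in> F2_vecs n" "y \<in> F2_vecs n"
  shows "pmf (correlated_pmf n \<rho>) (x, y) =
    (\<Prod>i=1..n. if y i = x i then (1 + \<rho>) / 2 else (1 - \<rho>) / 2) / 2 ^ n"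
proof -
  let ?h = "\<lambda>(x, z). (x, \<lambda>i. x i + z i) :: (nat \<Rightarrow> bit) \<times> (nat \<Rightarrow> bit)"
  let ?z = "\<lambda>i. x i + y i"
  let ?q = "map_pmf (\<lambda>b. if b then 0 else 1 :: bit) (bernoulli_pmf ((1 + \<rho>) / 2))"
  have add_cancel: "a + (a + b) = b" for a b :: bit
    by (cases a; cases b) auto
  have inj: "inj ?h"
  proof (rule inj_on_inverseI)
    show "?h (?h p) = p" for p
      by (cases p) (simp only: prod.case add_cancel)
  qed
  have h: "?h (x, ?z) = (x, y)"
    by (simp only: prod.case add_cancel)
  have q: "pmf ?q (a + b) = (if b = a then (1 + \<rho>) / 2 else (1 - \<rho>) / 2)" for a b
  proof -
    have v: "(\<lambda>b. if b then 0 else 1 :: bit) -` {0} = {True}"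
      "(\<lambda>b. if b then 0 else 1 :: bit) -` {1} = {False}"
      by (auto split: if_splits)
    have "pmf ?q 0 = (1 + \<rho>) / 2" "pmf ?q 1 = (1 - \<rho>) / 2"
      using \<rho> by (simp_all add: pmf_map v measure_pmf_single field_simps)
    thus ?thesis
      by (cases a; cases b) auto
  qed
  have z: "pmf (noise_pmf n \<rho>) ?z = (\<Prod>i=1..n. if y i = x i then (1 + \<rho>) / 2 else (1 - \<rho>) / 2)"
  proof -
    have "?z i = 0" if "i \<notin> {1..n}" for i
      using xy that unfolding F2_vecs_def by (auto simp del: atLeastAtMost_iff)
    hence "pmf (noise_pmf n \<rho>) ?z = (\<Prod>i=1..n. pmf ?q (?z i))"
      unfolding noise_pmf_def by (intro pmf_Pi') auto
    thus ?thesis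
      by (simp only: q)
  qed
  have "pmf (correlated_pmf n \<rho>) (x, y) =
      pmf (pair_pmf (pmf_of_set (F2_vecs n)) (noise_pmf n \<rho>)) (x, ?z)"
    unfolding correlated_pmf_def h [symmetric] by (rule pmf_map_inj' [OF inj])
  also have "\<dots> = pmf (pmf_of_set (F2_vecs n)) x * pmf (noise_pmf n \<rho>) ?z"
    by (rule pmf_pair)
  finally show ?thesis
    unfolding z using xy by (simp add: card_F2_vecs)
qed

end

theory Submission
  imports Defs
begin

text \<open>
  The law of \<open>(f X, f Y)\<close> depends on \<open>\<rho>\<close> only through \<open>E [f X f Y] = \<mu>\<^sup>2 + T\<close>, where \<open>\<mu> = E f\<close> and
  \<open>T = \<Sum>A\<noteq>{}. W A * \<rho> ^ card A\<close> with the Fourier weights \<open>W A\<close>, whose total is \<open>1 - \<mu>\<^sup>2\<close>. If \<open>M\<close> is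
  the claimed maximum, then \<open>(k * \<rho> ^ (k - 1))\<^sup>2 \<le> M * (1 - \<rho> ^ (2 * k))\<close> for all \<open>k\<close>, and two
  applications of Cauchy-Schwarz with the weights \<open>W\<close> give \<open>T'\<^sup>2 \<le> M * ((1 - \<mu>\<^sup>2)\<^sup>2 - T\<^sup>2)\<close>. With
  \<open>D = 1 - \<mu>\<^sup>2\<close> and \<open>q = (D + T)\<^sup>2 + 4 * \<mu>\<^sup>2 * T\<close>, the Fisher information is
  \<open>T'\<^sup>2 * (D + T) / (q * (D - T))\<close>, which is at most \<open>M\<close> because \<open>T \<ge> 0\<close> for \<open>\<rho> \<ge> 0\<close>.
\<close>

section \<open>Fourier expansion of the noise kernel and of correlations\<close>

definition sgn_bit :: "bit \<Rightarrow> real" where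
  "sgn_bit b = (if b = 0 then 1 else -1)"

definition fourier_coeff :: "nat \<Rightarrow> ((nat \<Rightarrow> bit) \<Rightarrow> real) \<Rightarrow> nat set \<Rightarrow> real" where
  "fourier_coeff n f A = (\<Sum>x\<in>F2_vecs n. f x * (\<Prod>i\<in>A. sgn_bit (x i))) / 2 ^ n"

text \<open>Two bits agree exactly when the product of their signs is 1, so each factor is
  \<open>(r * sgn_bit (x i) * sgn_bit (y i) + 1) / 2\<close>; multiplying out over \<open>I\<close>
  gives one term per subset.\<close>

lemma noise_kernel_expansion:
  fixes r :: real
  assumes "finite I"
  shows "(\<Prod>i\<in>I. if y i = x i then (1 + r) / 2 else (1 - r) / 2) =
    (\<Sum>A\<in>Pow I. r ^ card A * (\<Prod>i\<in>A. sgn_bit (x i)) * (\<Prod>i\<in>A. sgn_bit (y i))) / 2 ^ card I"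
proof -
  have "(\<Prod>i\<in>I. if y i = x i then (1 + r) / 2 else (1 - r) / 2) =
      (\<Prod>i\<in>I. (r * sgn_bit (x i) * sgn_bit (y i) + 1) / 2)"
  proof (intro prod.cong refl)
    show "(if y i = x i then (1 + r) / 2 else (1 - r) / 2) =
        (r * sgn_bit (x i) * sgn_bit (y i) + 1) / 2" for i
      by (cases "x i"; cases "y i") (auto simp: sgn_bit_def)
  qed
  thus ?thesis
    using assms by (simp add: prod_dividef prod_add prod.distrib)
qed

lemma set_correlated_pmf: "set_pmf (correlated_pmf n r) \<subseteq> F2_vecs n \<times> F2_vecs n"
proof -
  have "set_pmf (noise_pmf n r) \<subseteq> F2_vecs n"
    unfolding noise_pmf_def F2_vecs_eq_PiE_dflt
    by (intro order.trans [OF set_Pi_pmf_subset]) (auto simp: PiE_dflt_def)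
  moreover have "(\<lambda>i. x i + z i) \<in> F2_vecs n" if "x \<in> F2_vecs n" "z \<in> F2_vecs n" for x z
    using that by (auto simp: F2_vecs_def)
  ultimately show ?thesis
    by (auto simp: correlated_pmf_def)
qed

text \<open>Every term of the expanded kernel separates \<open>x\<close> from \<open>y\<close>, so
  after exchanging the sums the double sum for each \<open>A\<close> factors into two
  coefficients.\<close>

lemma expectation_correlated_prod:
  assumes r: "r \<in> {-1..1}"
  shows "measure_pmf.expectation (correlated_pmf n r) (\<lambda>(x, y). g x * h y) =
    (\<Sum>A\<in>Pow {1..n}. fourier_coeff n g A * fourier_coeff n h A * r ^ card A)"
proof -
  let ?F = "F2_vecs n"
  let ?c = "\<lambda>A x. \<Prod>i\<in>A. sgn_bit (x i)"
  have "measure_pmf.expectation (correlated_pmf n r) (\<lambda>(x, y). g x * h y) =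
      (\<Sum>p\<in>?F \<times> ?F. pmf (correlated_pmf n r) p *\<^sub>R (case p of (x, y) \<Rightarrow> g x * h y))"
    by (rule integral_measure_pmf) (use set_correlated_pmf in auto)
  also have "\<dots> = (\<Sum>x\<in>?F. \<Sum>y\<in>?F. pmf (correlated_pmf n r) (x, y) * (g x * h y))"
    by (simp add: sum.cartesian_product case_prod_unfold)
  also have "\<dots> = (\<Sum>x\<in>?F. \<Sum>y\<in>?F. \<Sum>A\<in>Pow {1..n}.
      (g x * ?c A x / 2 ^ n) * (h y * ?c A y / 2 ^ n) * r ^ card A)"
  proof (intro sum.cong refl)
    fix x y assume "x \<in> ?F" "y \<in> ?F"
    then show "pmf (correlated_pmf n r) (x, y) * (g x * h y) = (\<Sum>A\<in>Pow {1..n}.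
        (g x * ?c A x / 2 ^ n) * (h y * ?c A y / 2 ^ n) * r ^ card A)"
      using r by (simp add: pmf_correlated_pmf noise_kernel_expansion
        sum_distrib_left sum_distrib_right sum_divide_distrib mult_ac)
  qed
  also have "\<dots> = (\<Sum>A\<in>Pow {1..n}. \<Sum>x\<in>?F. \<Sum>y\<in>?F.
      (g x * ?c A x / 2 ^ n) * (h y * ?c A y / 2 ^ n) * r ^ card A)"
    by (simp only: sum.swap [where A = "Pow {1..n}" and B = ?F])
  also have "\<dots> = (\<Sum>A\<in>Pow {1..n}. fourier_coeff n g A * fourier_coeff n h A * r ^ card A)"
    unfolding fourier_coeff_def by (simp only: sum_divide_distrib sum_product) (simp only: sum_distrib_right)
  finally show ?thesis .
qed

lemma fourier_coeff_empty:
  "fourier_coeff n f {} = measure_pmf.expectation (pmf_of_set (F2_vecs n)) f"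
  by (simp add: fourier_coeff_def integral_pmf_of_set card_F2_vecs)

text \<open>The noise changes only the second component, so the first keeps the uniform law.\<close>

lemma expectation_correlated_fst:
  "measure_pmf.expectation (correlated_pmf n r) (\<lambda>(x, y). g x) = fourier_coeff n g {}"
proof -
  have "map_pmf fst (correlated_pmf n r) =
      map_pmf fst (pair_pmf (pmf_of_set (F2_vecs n)) (noise_pmf n r))"
    unfolding correlated_pmf_def pmf.map_comp by (intro map_pmf_cong) auto
  also have "\<dots> = pmf_of_set (F2_vecs n)"
    by (rule map_fst_pair_pmf)
  finally have "fourier_coeff n g {} =
      measure_pmf.expectation (map_pmf fst (correlated_pmf n r)) g"
    by (simp add: fourier_coeff_empty)
  also have "\<dots> = measure_pmf.expectation (correlated_pmf n r) (\<lambda>(x, y). g x)"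
    by (simp add: case_prod_unfold)
  finally show ?thesis by simp
qed

text \<open>The correlation formula is symmetric in its two functions; pairing \<open>g\<close> with
  the constant 1 on either side equates the two marginal means.\<close>

lemma expectation_correlated_snd:
  assumes "r \<in> {-1..1}"
  shows "measure_pmf.expectation (correlated_pmf n r) (\<lambda>(x, y). g y) = fourier_coeff n g {}"
proof -
  have "measure_pmf.expectation (correlated_pmf n r) (\<lambda>(x, y). g y) =
      measure_pmf.expectation (correlated_pmf n r) (\<lambda>(x, y). g x)"
    using expectation_correlated_prod [OF assms, of n "\<lambda>_. 1" g]
      expectation_correlated_prod [OF assms, of n g "\<lambda>_. 1"]
    by (simp add: mult_ac)
  thus ?thesis
    by (simp add: expectation_correlated_fst)
qed

text \<open>At correlation 1 the noise vanishes, so Parseval is the evaluation of the noise formula there.\<close>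

lemma parseval:
  "(\<Sum>A\<in>Pow {1..n}. (fourier_coeff n f A)\<^sup>2) = (\<Sum>x\<in>F2_vecs n. (f x)\<^sup>2) / 2 ^ n"
proof -
  have noise: "noise_pmf n 1 = return_pmf (\<lambda>_. 0)"
  proof -
    have "bernoulli_pmf 1 = return_pmf True"
      by (rule pmf_eqI) (auto simp: indicator_def split: bool.splits)
    thus ?thesis
      by (simp add: noise_pmf_def Pi_pmf_return_pmf)
  qed
  have "(\<Sum>A\<in>Pow {1..n}. (fourier_coeff n f A)\<^sup>2) =
      measure_pmf.expectation (correlated_pmf n 1) (\<lambda>(x, y). f x * f y)"
    by (simp add: expectation_correlated_prod power2_eq_square)
  also have "correlated_pmf n 1 = map_pmf (\<lambda>x. (x, x)) (pmf_of_set (F2_vecs n))"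
    unfolding correlated_pmf_def noise pair_return_pmf2 pmf.map_comp
    by (simp only: o_def prod.case add_0_right)
  finally show ?thesis
    by (simp add: integral_pmf_of_set card_F2_vecs power2_eq_square)
qed

section \<open>The law of the output pair\<close>

definition signs :: "(real \<times> real) set" where "signs = {-1, 1} \<times> {-1, 1}"

lemma set_output_pmf:
  assumes "f \<in> F2_vecs n \<rightarrow> {-1, 1}"
  shows "set_pmf (output_pmf n f f r) \<subseteq> signs"
  using assms set_correlated_pmf [of n r] unfolding output_pmf_def signs_def by fastforce

lemma expectation_output_pmf:
  fixes \<phi> :: "real \<times> real \<Rightarrow> real"
  assumes "f \<in> F2_vecs n \<rightarrow> {-1, 1}"
  shows "measure_pmf.expectation (correlated_pmf n r) (\<lambda>(x, y). \<phi> (f x, f y)) =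
    (\<Sum>p\<in>signs. pmf (output_pmf n f f r) p * \<phi> p)"
proof -
  have "measure_pmf.expectation (correlated_pmf n r) (\<lambda>(x, y). \<phi> (f x, f y)) =
      measure_pmf.expectation (output_pmf n f f r) \<phi>"
    by (simp add: output_pmf_def case_prod_unfold)
  also have "\<dots> = (\<Sum>p\<in>signs. pmf (output_pmf n f f r) p *\<^sub>R \<phi> p)"
    by (rule integral_measure_pmf) (use set_output_pmf [OF assms] in \<open>auto simp: signs_def\<close>)
  finally show ?thesis by simp
qed

text \<open>On \<open>signs\<close> the indicator of \<open>(u, v)\<close> is the polynomial
  \<open>(1 + u * fst p) * (1 + v * snd p) / 4\<close>, whose expectation involves only the two
  means, which are equal, and the correlation.\<close>

lemma pmf_output_pmf:
  assumes f: "f \<in> F2_vecs n \<rightarrow> {-1, 1}" and r: "r \<in> {-1..1}" and uv: "(u, v) \<in> signs"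
  shows "pmf (output_pmf n f f r) (u, v) =
    (1 + (u + v) * fourier_coeff n f {} +
      u * v * (\<Sum>A\<in>Pow {1..n}. (fourier_coeff n f A)\<^sup>2 * r ^ card A)) / 4"
proof -
  let ?M = "correlated_pmf n r"
  let ?E = "measure_pmf.expectation ?M"
  have [simp]: "integrable (measure_pmf ?M) h" for h :: "_ \<Rightarrow> real"
    by (intro integrable_measure_pmf_finite finite_subset [OF set_correlated_pmf]) simp
  have "pmf (output_pmf n f f r) (u, v) =
      (\<Sum>p\<in>signs. pmf (output_pmf n f f r) p * ((1 + u * fst p) * (1 + v * snd p) / 4))"
    using uv by (auto simp: signs_def simp flip: sum.cartesian_product)
  also have "\<dots> = ?E (\<lambda>(x, y). (1 + u * f x) * (1 + v * f y) / 4)"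
    using expectation_output_pmf [OF f, of r "\<lambda>p. (1 + u * fst p) * (1 + v * snd p) / 4"] by simp
  also have "\<dots> = ?E (\<lambda>p. 1/4 + u/4 * (case p of (x, y) \<Rightarrow> f x) + v/4 * (case p of (x, y) \<Rightarrow> f y)
      + u * v / 4 * (case p of (x, y) \<Rightarrow> f x * f y))"
    by (intro Bochner_Integration.integral_cong) (auto simp: field_simps)
  also have "\<dots> = 1/4 + u/4 * fourier_coeff n f {} + v/4 * fourier_coeff n f {} +
      u * v / 4 * (\<Sum>A\<in>Pow {1..n}. (fourier_coeff n f A)\<^sup>2 * r ^ card A)"
    using r by (simp add: expectation_correlated_fst expectation_correlated_snd
      expectation_correlated_prod power2_eq_square)
  finally show ?thesis
    by (simp add: field_simps)
qed

text \<open>Groups the pairs \<open>(x, y)\<close> by their outputs; an output of probability 0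
  contributes 0 whatever \<open>deriv\<close> returns there.\<close>

lemma fisher_info_eq:
  assumes f: "f \<in> F2_vecs n \<rightarrow> {-1, 1}"
  shows "fisher_info n f f \<rho> =
    (\<Sum>p\<in>signs. pmf (output_pmf n f f \<rho>) p * (deriv (\<lambda>r. ln (pmf (output_pmf n f f r) p)) \<rho>)\<^sup>2)"
  unfolding fisher_info_def
  using expectation_output_pmf [OF f, of \<rho> "\<lambda>p. (deriv (\<lambda>r. ln (pmf (output_pmf n f f r) p)) \<rho>)\<^sup>2"]
  by simp

section \<open>Cauchy-Schwarz estimates and the bound for two correlated signs\<close>

lemma weighted_Cauchy_Schwarz:
  fixes W d :: "'a \<Rightarrow> real"
  assumes "\<And>i. i \<in> I \<Longrightarrow> 0 \<le> W i"
  shows "(\<Sum>i\<in>I. W i * d i)\<^sup>2 \<le> sum W I * (\<Sum>i\<in>I. W i * (d i)\<^sup>2)"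
proof -
  have "(\<Sum>i\<in>I. W i * d i)\<^sup>2 = (\<Sum>i\<in>I. sqrt (W i) * (sqrt (W i) * d i))\<^sup>2"
    using assms by (intro arg_cong [where f = "\<lambda>x. x\<^sup>2"] sum.cong) (auto simp: mult.assoc [symmetric])
  also have "\<dots> \<le> (\<Sum>i\<in>I. (sqrt (W i))\<^sup>2) * (\<Sum>i\<in>I. (sqrt (W i) * d i)\<^sup>2)"
    by (rule Cauchy_Schwarz_ineq_sum)
  also have "\<dots> = sum W I * (\<Sum>i\<in>I. W i * (d i)\<^sup>2)"
    using assms by (simp add: power_mult_distrib)
  finally show ?thesis .
qed

text \<open>Cauchy-Schwarz acts twice: on the sum with \<open>d\<close> directly, and behind the
  minus sign on the sum with \<open>t\<close>. The intended \<open>t\<close> is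
  \<open>\<rho> ^ card A\<close>, with \<open>d\<close> its derivative.\<close>

lemma weighted_derivative_bound:
  fixes W t d :: "'a \<Rightarrow> real"
  assumes W: "\<And>i. i \<in> I \<Longrightarrow> 0 \<le> W i"
    and d: "\<And>i. i \<in> I \<Longrightarrow> (d i)\<^sup>2 \<le> M * (1 - (t i)\<^sup>2)" and M: "0 \<le> M"
  shows "(\<Sum>i\<in>I. W i * d i)\<^sup>2 \<le> M * ((sum W I)\<^sup>2 - (\<Sum>i\<in>I. W i * t i)\<^sup>2)"
proof -
  have "(\<Sum>i\<in>I. W i * d i)\<^sup>2 \<le> sum W I * (\<Sum>i\<in>I. W i * (d i)\<^sup>2)"
    using W by (rule weighted_Cauchy_Schwarz)
  also have "\<dots> \<le> sum W I * (\<Sum>i\<in>I. W i * (M * (1 - (t i)\<^sup>2)))"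
    using W d by (intro mult_left_mono sum_mono sum_nonneg) auto
  also have "\<dots> = M * ((sum W I)\<^sup>2 - sum W I * (\<Sum>i\<in>I. W i * (t i)\<^sup>2))"
    by (simp add: sum_distrib_left sum_subtractf algebra_simps power2_eq_square)
  also have "\<dots> \<le> M * ((sum W I)\<^sup>2 - (\<Sum>i\<in>I. W i * t i)\<^sup>2)"
    using weighted_Cauchy_Schwarz [of I W t] W M by (intro mult_left_mono diff_left_mono) auto
  finally show ?thesis .
qed

text \<open>For signs with common mean \<open>\<mu>\<close> and expected product \<open>S\<close>,
  the denominators are four times the probabilities of \<open>(1, 1)\<close>,
  \<open>(-1, -1)\<close> and either mixed outcome. With \<open>d\<close> the derivative of
  \<open>S\<close>, the last claim bounds the Fisher information.\<close>

lemma sign_pair_information_bound: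
  fixes \<mu> T d M :: real
  defines "S \<equiv> \<mu>\<^sup>2 + T"
  assumes T: "0 \<le> T" "T < 1 - \<mu>\<^sup>2" and d: "d\<^sup>2 \<le> M * ((1 - \<mu>\<^sup>2)\<^sup>2 - T\<^sup>2)"
  shows "0 < 1 + 2 * \<mu> + S" "0 < 1 - 2 * \<mu> + S" "0 < 1 - S"
    and "d\<^sup>2 / 4 * (1 / (1 + 2 * \<mu> + S) + 1 / (1 - 2 * \<mu> + S) + 2 / (1 - S)) \<le> M"
proof -
  have e: "1 + 2 * \<mu> + S = (1 + \<mu>)\<^sup>2 + T" "1 - 2 * \<mu> + S = (1 - \<mu>)\<^sup>2 + T"
    by (auto simp: S_def power2_eq_square algebra_simps)
  have "\<mu>\<^sup>2 < 1"
    using T by linarith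
  hence \<mu>: "1 + \<mu> \<noteq> 0" "1 - \<mu> \<noteq> 0"
    by (auto simp: add_eq_0_iff)
  show a: "0 < 1 + 2 * \<mu> + S" and b: "0 < 1 - 2 * \<mu> + S"
    unfolding e using \<mu> T by (auto intro: add_pos_nonneg)
  show c: "0 < 1 - S"
    using T by (simp add: S_def)
  let ?q = "(1 + 2 * \<mu> + S) * (1 - 2 * \<mu> + S)"
  let ?D = "1 - \<mu>\<^sup>2"
  have q: "?q = (?D + T)\<^sup>2 + 4 * \<mu>\<^sup>2 * T"
    by (simp add: S_def power2_eq_square algebra_simps)
  have q0: "0 < ?q"
    using a b by simp
  \<comment> \<open>Forced by the bound on \<open>d\<^sup>2\<close>, whose other factor is
    positive.\<close>
  have "0 \<le> M"
  proof -
    have "T\<^sup>2 < ?D\<^sup>2"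
      using T by (intro power_strict_mono) auto
    moreover have "0 \<le> M * (?D\<^sup>2 - T\<^sup>2)"
      using d by (rule order.trans [rotated]) simp
    ultimately show ?thesis
      by (simp add: zero_le_mult_iff)
  qed
  have c': "1 - S = ?D - T"
    by (simp add: S_def)
  have "1 / (1 + 2 * \<mu> + S) + 1 / (1 - 2 * \<mu> + S) = 2 * (1 + S) / ?q"
    using a b by (simp add: add_frac_eq)
  hence "1 / (1 + 2 * \<mu> + S) + 1 / (1 - 2 * \<mu> + S) + 2 / (1 - S) =
      (2 * (1 + S) * (1 - S) + 2 * ?q) / (?q * (1 - S))"
    using q0 c by (simp only:) (subst add_frac_eq, auto)
  \<comment> \<open>Since \<open>?q = (1 + S)\<^sup>2 - 4 * \<mu>\<^sup>2\<close>, the squares of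
    \<open>S\<close> cancel.\<close>
  also have "2 * (1 + S) * (1 - S) + 2 * ?q = 4 * (?D + T)"
    by (simp add: S_def power2_eq_square algebra_simps)
  finally have sum: "1 / (1 + 2 * \<mu> + S) + 1 / (1 - 2 * \<mu> + S) + 2 / (1 - S) =
      4 * (?D + T) / (?q * (1 - S))" .
  have "d\<^sup>2 / 4 * (1 / (1 + 2 * \<mu> + S) + 1 / (1 - 2 * \<mu> + S) + 2 / (1 - S)) =
      d\<^sup>2 * (?D + T) / (?q * (1 - S))"
  proof -
    have "d\<^sup>2 / 4 * (4 * x / y) = d\<^sup>2 * x / y" for x y
      by simp
    thus ?thesis
      unfolding sum .
  qed
  also have "\<dots> \<le> M"
  proof -
    have "d\<^sup>2 * (?D + T) \<le> M * (?D\<^sup>2 - T\<^sup>2) * (?D + T)"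
      using d T by (intro mult_right_mono) auto
    also have "\<dots> = M * ((?D + T)\<^sup>2 * (1 - S))"
      unfolding c' by (simp add: power2_eq_square algebra_simps)
    \<comment> \<open>\<open>T \<ge> 0\<close> makes \<open>4 * \<mu>\<^sup>2 * T\<close>
      nonnegative, so \<open>(?D + T)\<^sup>2\<close> is at most \<open>?q\<close>.\<close>
    also have "\<dots> \<le> M * (?q * (1 - S))"
      unfolding q using \<open>0 \<le> M\<close> T c by (intro mult_left_mono mult_right_mono) auto
    finally show ?thesis
      using q0 c by (simp add: pos_divide_le_eq)
  qed
  finally show "d\<^sup>2 / 4 * (1 / (1 + 2 * \<mu> + S) + 1 / (1 - 2 * \<mu> + S) + 2 / (1 - S)) \<le> M" .
qed

section \<open>The Fisher information of a Boolean function\<close>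

theorem theorem5:
  fixes n :: nat and \<rho> :: real and f :: "(nat \<Rightarrow> bit) \<Rightarrow> real"
  assumes "n \<ge> 1"
    and "\<rho> \<in> {0..<1}"
    and "f \<in> F2_vecs n \<rightarrow> {-1, 1}"
  shows "fisher_info n f f \<rho>
    \<le> (MAX k\<in>{1..n}. (real k)\<^sup>2 * \<rho> ^ (2 * (k - 1)) / (1 - \<rho> ^ (2 * k)))"
proof -
  define c where "c = (\<lambda>k. (real k)\<^sup>2 * \<rho> ^ (2 * (k - 1)) / (1 - \<rho> ^ (2 * k)))"
  define M where "M = (MAX k\<in>{1..n}. c k)"
  \<comment> \<open>The empty set is left out: its term is constant in \<open>r\<close>, and the
    maximum starts at \<open>k = 1\<close>.\<close>
  define I where "I = Pow {1..n} - {{}}"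
  define W where "W = (\<lambda>A. (fourier_coeff n f A)\<^sup>2)"
  define \<mu> where "\<mu> = fourier_coeff n f {}"
  define T where "T = (\<lambda>r. \<Sum>A\<in>I. W A * r ^ card A)"
  define d where "d = (\<Sum>A\<in>I. W A * (card A * \<rho> ^ (card A - 1)))"
  \<comment> \<open>\<open>P\<close> is polynomial in \<open>r\<close> on the whole line, unlike the
    clamped probabilities, and can be differentiated directly; \<open>d\<close> is the derivative of
    \<open>T\<close> at \<open>\<rho>\<close>.\<close>
  define P where "P = (\<lambda>r (u, v). (1 + (u + v) * \<mu> + u * v * (\<mu>\<^sup>2 + T r)) / 4)"
  note f = assms(3)
  have \<rho>: "0 \<le> \<rho>" "\<rho> < 1"
    using assms(2) by auto
  have W: "0 \<le> W A" for A
    by (simp add: W_def)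
  have I: "finite I" "card A \<in> {1..n}" if "A \<in> I" for A
  proof -
    have A: "A \<subseteq> {1..n}" "A \<noteq> {}" using that by (auto simp: I_def)
    hence "finite A" by (auto intro: finite_subset)
    with A show "card A \<in> {1..n}"
      using card_mono [of "{1..n}" A] by (simp add: Suc_le_eq card_gt_0_iff)
  qed (simp add: I_def)
  have split: "(\<Sum>A\<in>Pow {1..n}. W A * r ^ card A) = \<mu>\<^sup>2 + T r" for r
    unfolding T_def I_def by (subst sum.remove [of _ "{}"]) (auto simp: W_def \<mu>_def)
  have total: "sum W I = 1 - \<mu>\<^sup>2"
  proof -
    have "(f x)\<^sup>2 = 1" if "x \<in> F2_vecs n" for x
      using f that by (auto simp: Pi_iff)
    hence "sum W (Pow {1..n}) = 1"
      using parseval [of n f] by (simp add: W_def card_F2_vecs)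
    \<comment> \<open>At \<open>r = 1\<close> all powers are 1, so \<open>T 1\<close> is the total
      weight \<open>sum W I\<close>.\<close>
    thus ?thesis
      using split [of 1] by (simp add: T_def)
  qed
  have P: "pmf (output_pmf n f f r) p = P r p" if "r \<in> {-1<..<1}" "p \<in> signs" for r p
    using that pmf_output_pmf [OF f, of r "fst p" "snd p"] split [of r]
    by (simp add: P_def W_def \<mu>_def case_prod_unfold)
  have dP: "((\<lambda>r. P r (u, v)) has_field_derivative u * v * d / 4) (at \<rho>)" for u v
    unfolding P_def T_def d_def prod.case
    by (auto intro!: derivative_eq_intros sum.cong simp: sum_distrib_left)
  have fisher: "fisher_info n f f \<rho> =
      (\<Sum>p\<in>signs. P \<rho> p * (deriv (\<lambda>r. ln (P r p)) \<rho>)\<^sup>2)"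
  proof -
    have "deriv (\<lambda>r. ln (pmf (output_pmf n f f r) p)) \<rho> = deriv (\<lambda>r. ln (P r p)) \<rho>"
      if "p \<in> signs" for p
    proof (rule deriv_cong_ev [OF _ refl])
      \<comment> \<open>The derivative needs agreement on a neighbourhood of \<open>\<rho>\<close>,
        which for \<open>\<rho> = 0\<close> contains negative \<open>r\<close>.\<close>
      have "\<forall>\<^sub>F r in nhds \<rho>. r \<in> {-1<..<1}"
        using \<rho> by (intro eventually_nhds_in_open) auto
      thus "\<forall>\<^sub>F r in nhds \<rho>. ln (pmf (output_pmf n f f r) p) = ln (P r p)"
        by eventually_elim (simp add: P that)
    qed
    thus ?thesis
      using \<rho> by (simp add: fisher_info_eq [OF f] P)
  qed
  have pow: "\<rho> ^ k < 1" if "k \<ge> 1" for k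
    using \<rho> that by (simp add: power_less_one_iff)
  have le_M: "(real k * \<rho> ^ (k - 1))\<^sup>2 \<le> M * (1 - (\<rho> ^ k)\<^sup>2)" if "k \<in> {1..n}" for k
  proof -
    have "c k \<le> M"
      unfolding M_def using that by (intro Max_ge) auto
    moreover have "0 < 1 - \<rho> ^ (2 * k)"
      using pow [of "2 * k"] that by simp
    ultimately have "(real k)\<^sup>2 * \<rho> ^ (2 * (k - 1)) \<le> M * (1 - \<rho> ^ (2 * k))"
      by (simp add: c_def pos_divide_le_eq)
    thus ?thesis
      by (simp add: power_mult_distrib power_mult [symmetric] mult.commute)
  qed
  \<comment> \<open>The case \<open>k = 1\<close> suffices; it lies in the range because
    \<open>n \<ge> 1\<close>.\<close>
  have M: "0 \<le> M"
  proof -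
    have "0 \<le> (real 1 * \<rho> ^ (1 - 1))\<^sup>2" by simp
    also have "\<dots> \<le> M * (1 - (\<rho> ^ 1)\<^sup>2)"
      using assms(1) by (intro le_M) auto
    finally show ?thesis
      using pow [of 2] by (simp add: zero_le_mult_iff)
  qed
  have "fisher_info n f f \<rho> \<le> M"
  proof (cases "sum W I = 0")
    \<comment> \<open>Here \<open>f\<close> is constant, and the logarithm of an output probability 0 is a junk value.\<close>
    case True
    hence "\<forall>A\<in>I. W A = 0"
      using I(1) W by (subst (asm) sum_nonneg_eq_0_iff) (auto simp: I_def)
    hence "T = (\<lambda>r. 0)"
      by (simp add: T_def)
    \<comment> \<open>\<open>P\<close> no longer depends on \<open>r\<close>, so every derivative
      vanishes, whatever value \<open>ln\<close> has at 0.\<close>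
    hence "fisher_info n f f \<rho> = 0"
      unfolding fisher by (simp add: P_def case_prod_unfold)
    thus ?thesis
      using M by simp
  next
    case False
    have T: "0 \<le> T \<rho>" "T \<rho> < 1 - \<mu>\<^sup>2"
    proof -
      show "0 \<le> T \<rho>"
        unfolding T_def using W \<rho> by (intro sum_nonneg) auto
      \<comment> \<open>Since \<open>card A \<ge> 1\<close>, each power is at most
        \<open>\<rho>\<close>; then \<open>\<rho> < 1\<close> and the positive total weight give
        strictness.\<close>
      have "T \<rho> \<le> (\<Sum>A\<in>I. W A * \<rho>)"
        unfolding T_def
      proof (intro sum_mono mult_left_mono W)
        fix A assume "A \<in> I"
        thus "\<rho> ^ card A \<le> \<rho>"
          using I(2) [of A] \<rho> power_decreasing [of 1 "card A" \<rho>] by simp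
      qed
      also have "\<dots> = \<rho> * sum W I"
        by (simp add: sum_distrib_left mult.commute)
      also have "\<dots> < sum W I"
        using False \<rho> sum_nonneg [of I W] W by simp
      finally show "T \<rho> < 1 - \<mu>\<^sup>2"
        by (simp add: total)
    qed
    have "d\<^sup>2 \<le> M * ((sum W I)\<^sup>2 - (T \<rho>)\<^sup>2)"
      unfolding d_def T_def using W M I(2) le_M by (intro weighted_derivative_bound) auto
    note bound = sign_pair_information_bound [OF T this [unfolded total]]
    have P_pos: "0 < P \<rho> p" if "p \<in> signs" for p
      using bound(1-3) that by (auto simp: signs_def P_def)
    \<comment> \<open>The logarithmic derivative is \<open>u * v * d / 4\<close> over the
      probability; the sign \<open>u * v\<close> disappears in the square.\<close>
    have summand: "P \<rho> (u, v) * (deriv (\<lambda>r. ln (P r (u, v))) \<rho>)\<^sup>2 = d\<^sup>2 / (16 * P \<rho> (u, v))"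
      if "(u, v) \<in> signs" for u v
    proof -
      have "((\<lambda>r. ln (P r (u, v))) has_field_derivative u * v * d / 4 / P \<rho> (u, v)) (at \<rho>)"
        using P_pos [OF that] by (auto intro!: derivative_eq_intros dP)
      hence "deriv (\<lambda>r. ln (P r (u, v))) \<rho> = u * v * d / 4 / P \<rho> (u, v)"
        by (rule DERIV_imp_deriv)
      moreover have "(u * v)\<^sup>2 = 1"
        using that by (auto simp: signs_def)
      ultimately show ?thesis
        using P_pos [OF that] by (simp add: power_divide power_mult_distrib power2_eq_square)
    qed
    have "fisher_info n f f \<rho> = (\<Sum>(u, v)\<in>signs. d\<^sup>2 / (16 * P \<rho> (u, v)))"
      unfolding fisher by (intro sum.cong refl) (auto simp: summand)
    also have "\<dots> = d\<^sup>2 / (16 * P \<rho> (1, 1)) + d\<^sup>2 / (16 * P \<rho> (-1, -1)) +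
        d\<^sup>2 / (16 * P \<rho> (1, -1)) + d\<^sup>2 / (16 * P \<rho> (-1, 1))"
      by (simp add: signs_def flip: sum.cartesian_product)
    also have "\<dots> = d\<^sup>2 / 4 * (1 / (1 + 2 * \<mu> + (\<mu>\<^sup>2 + T \<rho>)) + 1 / (1 - 2 * \<mu> + (\<mu>\<^sup>2 + T \<rho>)) +
        2 / (1 - (\<mu>\<^sup>2 + T \<rho>)))"
    proof -
      have sum: "d\<^sup>2 / (16 * (a / 4)) + d\<^sup>2 / (16 * (b / 4)) + d\<^sup>2 / (16 * (e / 4)) +
          d\<^sup>2 / (16 * (e / 4)) = d\<^sup>2 / 4 * (1 / a + 1 / b + 2 / e)" for a b e
        by (simp add: ring_distribs)
      have "P \<rho> (1, 1) = (1 + 2 * \<mu> + (\<mu>\<^sup>2 + T \<rho>)) / 4"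
        "P \<rho> (-1, -1) = (1 - 2 * \<mu> + (\<mu>\<^sup>2 + T \<rho>)) / 4"
        "P \<rho> (1, -1) = (1 - (\<mu>\<^sup>2 + T \<rho>)) / 4" "P \<rho> (-1, 1) = (1 - (\<mu>\<^sup>2 + T \<rho>)) / 4"
        by (simp_all add: P_def)
      thus ?thesis
        by (simp only: sum)
    qed
    also have "\<dots> \<le> M"
      by (rule bound(4))
    finally show ?thesis .
  qed
  thus ?thesis
    by (simp add: M_def c_def)
qed

end
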